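(* Let $G$ be a caterpillar and let $P$ be a minimum $1$-center-path of $G$. Then $md(G)$ is finite if and only if every vertex of $P$ has at most $2$ neighbors in $G-P$, where $G-P$ is the graph obtained from $G$ by deleting the vertices of $P$.
   Context: All graphs are finite, simple and connected unless obtained by deletion. For vertices $u,v$ of a connected graph $G$, $d(u,v)$ is the length (number of edges) of a shortest path between them. For $W \subseteq V(G)$ and a vertex $v$, the representation multiset $r_m(v|W)$ is the multiset of the distances $d(v,w)$, $w \in W$ (counted with multiplicity; if $v\in W$, the distance $0$ is included). $W$ is an m-resolving set of $G$ if $r_m(u|W) \neq r_m(v|W)$ for every pair of distinct vertices $u,v$. If $G$ has an m-resolving set, the multiset dimension $md(G)$ is the cardinality of a smallest one; otherwise $md(G)=\infty$. A subgraph $P$ of a connected graph $G$ is a $k$-center-path of $G$ if $P$ is a path (a single vertex being a path of length $0$) and $d(u,P)\le k$ for every vertex $u$ of $G$, where $d(u,P)$ is the minimum distance from $u$ to a vertex of $P$. A minimum $k$-center-path is a $k$-center-path of minimum length. A caterpillar is a tree containing a $1$-center-path. *)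

theory Defs
  imports
    Graph_Theory.Digraph_Component
    "HOL-Library.Multiset"
    "HOL-Library.Extended_Nat"
begin

text \<open>
  A finite simple graph is a \<open>G\<close> satisfying the locale predicate \<open>graph\<close>: a finite symmetric
  digraph without loops or parallel arcs, so that each undirected edge is a pair of opposite arcs.
  Walks and paths are arc lists, hence \<open>length p\<close> is the number of edges traversed.
\<close>

text \<open>
  The constant \<open>tree\<close> of the library is unsuitable here: in a symmetric digraph, traversing an
  edge back and forth is a directed cycle of length 2. Directed cycles of length at least 3
  are exactly the (oriented) cycles of the undirected graph.
\<close>

definition undirected_tree :: "('a, 'b) pre_digraph \<Rightarrow> bool" where
  "undirected_tree G \<longleftrightarrow> graph G \<and> Digraph_Component.connected G \<and>
     \<not> (\<exists>p. pre_digraph.cycle G p \<and> 3 \<le> length p)"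

text \<open>
  The distance is meaningful only if \<open>v\<close> is reachable from \<open>u\<close>; it is used for connected graphs only.
\<close>

definition graph_dist :: "('a, 'b) pre_digraph \<Rightarrow> 'a \<Rightarrow> 'a \<Rightarrow> nat" where
  "graph_dist G u v = (LEAST n. \<exists>p. pre_digraph.apath G u p v \<and> length p = n)"

definition rep_mset :: "('a, 'b) pre_digraph \<Rightarrow> 'a \<Rightarrow> 'a set \<Rightarrow> nat multiset" where
  "rep_mset G v W = image_mset (graph_dist G v) (mset_set W)"

definition m_resolving :: "('a, 'b) pre_digraph \<Rightarrow> 'a set \<Rightarrow> bool" where
  "m_resolving G W \<longleftrightarrow> W \<subseteq> verts G \<and>
     (\<forall>u\<in>verts G. \<forall>v\<in>verts G. u \<noteq> v \<longrightarrow> rep_mset G u W \<noteq> rep_mset G v W)"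

definition multiset_dim :: "('a, 'b) pre_digraph \<Rightarrow> enat" where
  "multiset_dim G =
     (if \<exists>W. m_resolving G W then enat (LEAST n. \<exists>W. m_resolving G W \<and> card W = n) else \<infinity>)"

text \<open>
  \<open>path_graph H n\<close>: the graph \<open>H\<close> is a path with \<open>n\<close> edges, i.e. its vertices and (undirected)
  edges are those traversed by some path in \<open>H\<close> of length \<open>n\<close>.
\<close>

definition path_graph :: "('a, 'b) pre_digraph \<Rightarrow> nat \<Rightarrow> bool" where
  "path_graph H n \<longleftrightarrow> graph H \<and>
     (\<exists>u p v. pre_digraph.apath H u p v \<and> length p = n \<and>
        verts H = set (pre_digraph.awalk_verts H u p) \<and>
        arcs_ends H = arc_to_ends H ` set p \<union> (arc_to_ends H ` set p)\<inverse>)"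

definition center_path :: "('a, 'b) pre_digraph \<Rightarrow> nat \<Rightarrow> ('a, 'b) pre_digraph \<Rightarrow> bool" where
  "center_path G k P \<longleftrightarrow> subgraph P G \<and> (\<exists>n. path_graph P n) \<and>
     (\<forall>u\<in>verts G. Min (graph_dist G u ` verts P) \<le> k)"

definition minimum_center_path :: "('a, 'b) pre_digraph \<Rightarrow> nat \<Rightarrow> ('a, 'b) pre_digraph \<Rightarrow> bool" where
  "minimum_center_path G k P \<longleftrightarrow> center_path G k P \<and>
     (\<exists>n. path_graph P n \<and> (\<forall>Q m. center_path G k Q \<and> path_graph Q m \<longrightarrow> n \<le> m))"

definition caterpillar :: "('a, 'b) pre_digraph \<Rightarrow> bool" where
  "caterpillar G \<longleftrightarrow> undirected_tree G \<and> (\<exists>P. center_path G 1 P)"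

definition delete_verts_of :: "('a, 'b) pre_digraph \<Rightarrow> ('a, 'b) pre_digraph \<Rightarrow> ('a, 'b) pre_digraph" where
  "delete_verts_of G P = G \<restriction> (verts G - verts P)"

text \<open>
  Neighbors are taken with respect to \<open>G\<close>, since \<open>v\<close> itself need not be a vertex of \<open>H\<close>.
\<close>

definition neighbors_in :: "('a, 'b) pre_digraph \<Rightarrow> 'a \<Rightarrow> ('a, 'b) pre_digraph \<Rightarrow> 'a set" where
  "neighbors_in G v H = {w \<in> verts H. v \<rightarrow>\<^bsub>G\<^esub> w}"

end

theory Submission
  imports Defs "Graph_Theory.Vertex_Walk"
begin

text \<open>
  All vertices off a minimum 1-center-path \<open>v\<^sub>0, \<dots>, v\<^sub>n\<close> (the spine) are leaves hanging from it
  (the legs), because any other edge would close a cycle. Giving a vertex the position \<open>i\<close> of its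
  spine vertex and the height 0 (spine) or 1 (leg), the distance of two distinct vertices is the
  difference of the positions plus both heights (\<open>graph_dist_eq_cdist\<close>). The theorem is
  thereby a statement about this explicit metric (\<open>ex_resolving_iff\<close>), and minimality of
  the path only enters through the fact that both ends of a spine with at least one edge carry legs
  (\<open>ends_have_legs\<close>).

  Two legs of one spine vertex have the same distance to every third vertex, so a set that contains
  both or neither does not separate them. Among three legs there are always two such
  (\<open>resolving_card_legs_le\<close>).

  Conversely, let every spine vertex have at most two legs. For \<open>n = 0\<close> a single leg resolves.
  For \<open>n > 0\<close> let \<open>W\<close> consist of one vertex \<open>r\<^sub>k\<close> for each position \<open>k\<close>, a leg whenever there is one
  and \<open>v\<^sub>k\<close> otherwise, together with \<open>v\<^sub>0\<close>, which breaks the mirror symmetry. From the distance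
  multiset of a vertex \<open>x\<close> with position \<open>i\<close> and height \<open>h\<close> one reads off whether \<open>x \<in> W\<close> (does 0
  occur), the maximum \<open>max i (n - i) + 1 + h\<close>, and the sum. As every position carries one element of
  \<open>W\<close> apart from the extra one, the sum is an explicit quadratic polynomial in \<open>i\<close>, up to the
  correction for the height. For vertices of equal height, the maximum
  determines \<open>i\<close> up to reflection and the sum then decides, since the extra element adds \<open>i\<close> to it;
  the two legs of one position are told apart by membership in \<open>W\<close>. For a spine vertex against a
  leg, outside \<open>W\<close> the distance 1 distinguishes them, and inside \<open>W\<close> the maximum and the sum do so
  except for \<open>v\<^bsub>3j-1\<^esub>\<close> and \<open>r\<^sub>j\<close> with \<open>n = 4j - 2\<close>; there the numbers of elements of \<open>W\<close>
  within distance \<open>j\<close> differ (\<open>exceptional_pair\<close>).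
\<close>

section \<open>The metric of a caterpillar\<close>

lemma sum_abs_diff:
  fixes i n :: nat
  assumes "i \<le> n"
  shows "2 * (\<Sum>k\<le>n. \<bar>int i - int k\<bar>) = int i * (int i + 1) + (int n - int i) * (int n - int i + 1)"
  using assms
proof (induction n rule: dec_induct)
  case base
  have "2 * (\<Sum>k\<le>m. int m - int k) = int m * (int m + 1)" for m :: nat
    by (induction m) (simp_all add: algebra_simps sum.distrib sum_subtractf)
  moreover have "(\<Sum>k\<le>i. \<bar>int i - int k\<bar>) = (\<Sum>k\<le>i. int i - int k)"
    by (rule sum.cong) auto
  ultimately show ?case by simp
next
  case (step m)
  then show ?case by (simp add: algebra_simps)
qed

text \<open>
  The spine \<open>S\<close> has exactly one vertex at each of the positions \<open>0, \<dots>, n\<close>; a vertex outside \<open>S\<close> hangs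
  as a leaf from the spine vertex with the same position. No graph is mentioned here, so that the
  resolving sets can be studied by arithmetic alone.
\<close>
locale caterpillar_metric =
  fixes n :: nat and V S :: "'a set" and pos :: "'a \<Rightarrow> nat"
  assumes finite_V: "finite V"
    and spine_subset: "S \<subseteq> V"
    and bij_pos: "bij_betw pos S {..n}"
    and pos_le: "x \<in> V \<Longrightarrow> pos x \<le> n"
begin

definition height :: "'a \<Rightarrow> nat" where
  "height x = (if x \<in> S then 0 else 1)"

definition cdist :: "'a \<Rightarrow> 'a \<Rightarrow> nat" where
  "cdist x y = (if x = y then 0 else nat \<bar>int (pos x) - int (pos y)\<bar> + height x + height y)"

definition legs :: "nat \<Rightarrow> 'a set" where
  "legs k = {x \<in> V - S. pos x = k}"

definition spine :: "nat \<Rightarrow> 'a" where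
  "spine k = inv_into S pos k"

definition rep :: "'a \<Rightarrow> 'a set \<Rightarrow> nat multiset" where
  "rep x W = image_mset (cdist x) (mset_set W)"

definition resolving :: "'a set \<Rightarrow> bool" where
  "resolving W \<longleftrightarrow> W \<subseteq> V \<and> inj_on (\<lambda>x. rep x W) V"

lemma height_le: "height x \<le> 1"
  by (simp add: height_def)

lemma spine_in: "k \<le> n \<Longrightarrow> spine k \<in> S"
  using bij_pos by (auto simp: spine_def bij_betw_def intro: inv_into_into)

lemma pos_spine: "k \<le> n \<Longrightarrow> pos (spine k) = k"
  using bij_pos by (auto simp: spine_def bij_betw_def intro: f_inv_into_f)

lemma pos_inj: "x \<in> S \<Longrightarrow> y \<in> S \<Longrightarrow> pos x = pos y \<Longrightarrow> x = y"
  using bij_pos by (auto simp: bij_betw_def inj_on_def)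

lemma spine_pos: "x \<in> S \<Longrightarrow> spine (pos x) = x"
  by (metis pos_inj pos_le pos_spine spine_in spine_subset subsetD)

lemma finite_legs: "finite (legs k)"
  using finite_V by (simp add: legs_def)

lemma legs_height: "x \<in> legs k \<Longrightarrow> height x = 1 \<and> pos x = k \<and> x \<in> V \<and> x \<notin> S"
  by (simp add: legs_def height_def)

lemma int_cdist:
  "x \<noteq> y \<Longrightarrow> int (cdist x y) = \<bar>int (pos x) - int (pos y)\<bar> + int (height x) + int (height y)"
  by (simp add: cdist_def)

lemma cdist_eq_0_iff: "x \<in> V \<Longrightarrow> y \<in> V \<Longrightarrow> cdist x y = 0 \<longleftrightarrow> x = y"
  using pos_inj by (auto simp: cdist_def height_def split: if_splits)

lemma cdist_sym: "cdist x y = cdist y x"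
  by (auto simp: cdist_def)

lemma cdist_triangle: "cdist x z \<le> cdist x y + cdist y z"
  using height_le[of x] height_le[of y] height_le[of z]
  by (auto simp: cdist_def)

lemma set_mset_rep: "W \<subseteq> V \<Longrightarrow> set_mset (rep x W) = cdist x ` W"
  using finite_V by (simp add: rep_def finite_subset)

lemma zero_in_rep_iff: "W \<subseteq> V \<Longrightarrow> x \<in> V \<Longrightarrow> 0 \<in># rep x W \<longleftrightarrow> x \<in> W"
  using cdist_eq_0_iff by (auto simp: set_mset_rep image_iff)

text \<open>
  The transposition of the two legs preserves both \<open>W\<close> and the metric.
\<close>
lemma twin_legs_same_rep:
  assumes "x \<in> legs k" "y \<in> legs k" "x \<in> W \<longleftrightarrow> y \<in> W"
  shows "rep x W = rep y W"
proof -
  define \<sigma> where "\<sigma> w = (if w = x then y else if w = y then x else w)" for w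
  have inv: "\<sigma> (\<sigma> w) = w" for w
    by (auto simp: \<sigma>_def)
  have "\<sigma> ` W = W"
    using assms(3) by (auto simp: \<sigma>_def image_iff)
  moreover have "inj_on \<sigma> W"
    by (metis inj_onI inv)
  ultimately have W: "mset_set W = image_mset \<sigma> (mset_set W)"
    by (simp add: image_mset_mset_set)
  have "cdist y (\<sigma> w) = cdist x w" for w
    using assms(1,2)[THEN legs_height] by (auto simp: \<sigma>_def cdist_def)
  then show ?thesis
    unfolding rep_def by (subst (2) W) (simp add: multiset.map_comp o_def)
qed

text \<open>
  By the previous lemma, at most one leg of each position lies in \<open>W\<close> and at most one outside.
\<close>
lemma resolving_card_legs_le:
  assumes "resolving W"
  shows "card (legs k) \<le> 2"
proof -
  have "card (legs k \<inter> T) \<le> 1" if "\<And>x y. x \<in> T \<Longrightarrow> y \<in> T \<Longrightarrow> x \<in> W \<longleftrightarrow> y \<in> W" for T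
  proof -
    have "x = y" if "x \<in> legs k \<inter> T" "y \<in> legs k \<inter> T" for x y
    proof (rule inj_onD[of "\<lambda>x. rep x W" V])
      show "rep x W = rep y W"
        using that \<open>\<And>x y. x \<in> T \<Longrightarrow> y \<in> T \<Longrightarrow> x \<in> W \<longleftrightarrow> y \<in> W\<close> by (blast intro: twin_legs_same_rep)
    qed (use assms that in \<open>auto simp: resolving_def legs_def\<close>)
    then show ?thesis
      using finite_legs[of k] by (simp add: card_le_Suc0_iff_eq)
  qed
  from this[of W] this[of "- W"] have "card (legs k \<inter> W) + card (legs k \<inter> - W) \<le> 2"
    by fastforce
  moreover have "legs k = (legs k \<inter> W) \<union> (legs k \<inter> - W)"
    by blast
  ultimately show ?thesis
    by (metis card_Un_le le_trans)
qed

end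

section \<open>A resolving set for at most two legs per position\<close>

text \<open>
  The legs at both ends are what makes the eccentricities in \<open>Max_rep\<close> uniform.
\<close>
locale short_legged_caterpillar = caterpillar_metric +
  assumes card_legs_le: "card (legs k) \<le> 2"
    and legs_ends: "0 < n \<Longrightarrow> legs 0 \<noteq> {} \<and> legs n \<noteq> {}"
begin

definition branch :: "nat \<Rightarrow> 'a" where
  "branch k = (if legs k = {} then spine k else SOME x. x \<in> legs k)"

lemma branch_legs: "legs k \<noteq> {} \<Longrightarrow> branch k \<in> legs k"
  by (simp add: branch_def some_in_eq)

lemma branch_empty: "legs k = {} \<Longrightarrow> branch k = spine k"
  by (simp add: branch_def)

lemma branch_in: "k \<le> n \<Longrightarrow> branch k \<in> V"
  using branch_legs[of k] legs_height[of "branch k" k] spine_in[of k] spine_subset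
  by (cases "legs k = {}") (auto simp: branch_empty)

lemma pos_branch: "k \<le> n \<Longrightarrow> pos (branch k) = k"
  using branch_legs[of k] legs_height[of "branch k" k]
  by (cases "legs k = {}") (auto simp: branch_empty pos_spine)

lemma height_branch: "k \<le> n \<Longrightarrow> height (branch k) = (if legs k = {} then 0 else 1)"
  using branch_legs[of k] legs_height[of "branch k" k] spine_in[of k]
  by (cases "legs k = {}") (auto simp: branch_empty height_def)

lemma branch_inj: "inj_on branch {..n}"
  by (rule inj_on_inverseI[where g = pos]) (simp add: pos_branch)

lemma leg_unique_off_branch:
  assumes "x \<in> legs k" "y \<in> legs k" "x \<noteq> branch k" "y \<noteq> branch k"
  shows "x = y"
proof (rule ccontr)
  assume "x \<noteq> y"
  then have "card {branch k, x, y} = 3"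
    using assms by auto
  moreover have "{branch k, x, y} \<subseteq> legs k"
    using assms branch_legs[of k] by auto
  then have "card {branch k, x, y} \<le> card (legs k)"
    by (rule card_mono[OF finite_legs])
  ultimately show False
    using card_legs_le[of k] by simp
qed

text \<open>
  One vertex per position makes the sums of distances computable, whichever positions have legs. Where
  there are two legs the choice is forced up to symmetry. The additional vertex \<open>spine 0\<close> is needed to
  tell the two ends apart: with two legs at every position, the branches alone give mirror images the
  same multiset.
\<close>
definition landmarks :: "'a set" where
  "landmarks = insert (spine 0) (branch ` {..n})"

lemma landmarks_subset: "landmarks \<subseteq> V"
  using branch_in spine_in[of 0] spine_subset unfolding landmarks_def by blast

context
  assumes n_pos: "0 < n"
begin

lemma spine_0_not_branch: "spine 0 \<notin> branch ` {..n}"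
proof
  assume "spine 0 \<in> branch ` {..n}"
  then obtain k where "k \<le> n" "spine 0 = branch k"
    by auto
  moreover from this have "k = 0"
    using pos_branch[of k] pos_spine[of 0] by simp
  ultimately show False
    using branch_legs[of 0] legs_ends[OF n_pos] spine_in[of 0] by (simp add: legs_def)
qed

lemma sum_landmarks: "(\<Sum>w\<in>landmarks. f w) = f (spine 0) + (\<Sum>k\<le>n. f (branch k))" for f :: "'a \<Rightarrow> int"
  using spine_0_not_branch branch_inj by (simp add: landmarks_def sum.reindex)

lemma legs_in_landmarks:
  assumes "x \<in> legs k"
  shows "x \<in> landmarks \<longleftrightarrow> x = branch k"
proof -
  have "x \<noteq> spine 0" "k \<le> n"
    using legs_height[OF assms] spine_in[of 0] pos_le[of x] by auto
  moreover have "i = k" if "i \<le> n" "x = branch i" for i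
    using that legs_height[OF assms] pos_branch[of i] by simp
  ultimately show ?thesis
    unfolding landmarks_def by blast
qed

text \<open>
  The farthest landmark is the leg chosen at one of the two ends.
\<close>
lemma Max_rep:
  assumes "x \<in> V"
  shows "Max (set_mset (rep x landmarks)) = max (pos x) (n - pos x) + 1 + height x"
proof (rule Max_eqI)
  show "finite (set_mset (rep x landmarks))"
    by simp
  show "d \<le> max (pos x) (n - pos x) + 1 + height x" if d: "d \<in># rep x landmarks" for d
  proof -
    obtain w where "w \<in> landmarks" "d = cdist x w"
      using d unfolding set_mset_rep[OF landmarks_subset] by blast
    then show ?thesis
      using pos_le[OF assms] pos_le[of w] landmarks_subset height_le[of w]
      by (auto simp: cdist_def)
  qed
  have "\<exists>w\<in>landmarks. cdist x w = max (pos x) (n - pos x) + 1 + height x"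
  proof (cases "pos x \<le> n - pos x")
    case True
    then have "cdist x (branch n) = n - pos x + 1 + height x"
      using legs_ends[OF n_pos] pos_branch[of n] height_branch[of n] n_pos pos_le[OF assms]
      by (auto simp: cdist_def)
    then show ?thesis
      using True by (intro bexI[of _ "branch n"]) (auto simp: landmarks_def)
  next
    case False
    then have "cdist x (branch 0) = pos x + 1 + height x"
      using legs_ends[OF n_pos] pos_branch[of 0] height_branch[of 0] by (auto simp: cdist_def)
    then show ?thesis
      using False by (intro bexI[of _ "branch 0"]) (auto simp: landmarks_def)
  qed
  then show "max (pos x) (n - pos x) + 1 + height x \<in># rep x landmarks"
    unfolding set_mset_rep[OF landmarks_subset] by (metis imageI)
qed

text \<open>
  The uniform formula for the distance is wrong only for \<open>x\<close> itself, where it yields \<open>2 * height x\<close>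
  instead of 0; this is the correction for \<open>x \<in> landmarks\<close>. Doubling avoids the division in the sum of
  \<open>sum_abs_diff\<close>, and the single summand \<open>2 * int (pos x)\<close> stems from the extra landmark \<open>spine 0\<close>.
\<close>
lemma sum_rep:
  assumes "x \<in> V"
  shows "2 * int (\<Sum>\<^sub># (rep x landmarks)) + (if x \<in> landmarks then 4 * int (height x) else 0) =
    int (pos x) * (int (pos x) + 1) + (int n - int (pos x)) * (int n - int (pos x) + 1) + 2 * int (pos x)
      + 2 * int (height x) * (int n + 2) + 2 * (\<Sum>k\<le>n. int (height (branch k)))"
proof -
  define g where "g w = \<bar>int (pos x) - int (pos w)\<bar> + int (height x) + int (height w)" for w
  have fin: "finite landmarks"
    using landmarks_subset finite_V finite_subset by blast
  have "int (\<Sum>\<^sub># (rep x landmarks)) = (\<Sum>w\<in>landmarks. int (cdist x w))"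
    unfolding rep_def by (simp flip: sum_unfold_sum_mset)
  also have "\<dots> = (\<Sum>w\<in>landmarks. g w - (if w = x then 2 * int (height x) else 0))"
    by (rule sum.cong) (auto simp: g_def int_cdist, simp add: cdist_def)
  also have "\<dots> = (\<Sum>w\<in>landmarks. g w) - (if x \<in> landmarks then 2 * int (height x) else 0)"
    using fin by (simp add: sum_subtractf)
  also have "(\<Sum>w\<in>landmarks. g w) = int (pos x) + int (height x)
      + (\<Sum>k\<le>n. \<bar>int (pos x) - int k\<bar> + int (height x) + int (height (branch k)))"
    unfolding sum_landmarks
    using pos_spine[of 0] spine_in[of 0] by (simp add: g_def pos_branch height_def)
  finally have "int (\<Sum>\<^sub># (rep x landmarks)) + (if x \<in> landmarks then 2 * int (height x) else 0) =
      int (pos x) + int (height x) * (int n + 2)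
        + (\<Sum>k\<le>n. \<bar>int (pos x) - int k\<bar>) + (\<Sum>k\<le>n. int (height (branch k)))"
    by (simp add: sum.distrib algebra_simps)
  then show ?thesis
    using sum_abs_diff[OF pos_le[OF assms]] by (cases "x \<in> landmarks") simp_all
qed

text \<open>
  This is a function of the multiset, and it counts the landmarks in a ball (\<open>near_eq_card\<close>).
\<close>
definition near :: "nat \<Rightarrow> 'a \<Rightarrow> nat" where
  "near m x = size (filter_mset (\<lambda>d. d \<le> m) (rep x landmarks))"

lemma near_eq_card: "near m x = card {w \<in> landmarks. cdist x w \<le> m}"
proof -
  have "finite landmarks"
    using landmarks_subset finite_V finite_subset by blast
  then show ?thesis
    unfolding near_def rep_def by (simp add: filter_mset_image_mset filter_mset_mset_set)
qed

text \<open>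
  These two vertices can agree in maximum and sum. Let \<open>p = 2 * j - 1 = n div 2\<close> be the middle position.
  The ball of radius \<open>j\<close> around the spine vertex contains the landmarks of all \<open>2 * j - 1\<close> positions
  beyond \<open>p\<close>. The ball of that radius around the leg reaches only into the positions
  \<open>1, \<dots>, 2 * j - 2\<close>, whose number is smaller by one; \<open>spine 0\<close> is just out of reach, at distance
  \<open>j + 1\<close>. The branch at \<open>p\<close> lies in both balls if it is on the spine, and otherwise the second ball
  misses it.
\<close>
lemma exceptional_pair:
  assumes n: "n = 4 * j - 2" and j: "2 \<le> j" and legs: "legs j \<noteq> {}"
  shows "rep (spine (3 * j - 1)) landmarks \<noteq> rep (branch j) landmarks"
proof
  define p where "p = 2 * j - 1"
  define E where "E = (if legs p = {} then {p} else {})"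
  define v where "v = spine (3 * j - 1)"
  have fin: "finite landmarks"
    using landmarks_subset finite_V finite_subset by blast
  have le: "3 * j - 1 \<le> n" "j \<le> n" "p \<le> n"
    using n j by (auto simp: p_def)
  have posv: "pos v = 3 * j - 1" "height v = 0"
    using pos_spine[OF le(1)] spine_in[OF le(1)] by (simp_all add: v_def height_def)
  have posb: "pos (branch j) = j" "height (branch j) = 1"
    using pos_branch[OF le(2)] height_branch[OF le(2)] legs by auto
  have "branch ` ({2 * j..n} \<union> E) \<subseteq> {w \<in> landmarks. cdist v w \<le> j}"
  proof
    fix w assume "w \<in> branch ` ({2 * j..n} \<union> E)"
    then obtain k where "w = branch k" "k \<in> {2 * j..n} \<union> E"
      by blast
    then have k: "w = branch k" "k \<le> n" "2 * j \<le> k \<or> (k = p \<and> legs p = {})"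
      using le by (auto simp: E_def split: if_splits)
    then have "cdist v w \<le> j"
      using posv j n by (auto simp: cdist_def pos_branch height_branch p_def)
    then show "w \<in> {w \<in> landmarks. cdist v w \<le> j}"
      using k by (auto simp: landmarks_def)
  qed
  then have "card (branch ` ({2 * j..n} \<union> E)) \<le> near j v"
    unfolding near_eq_card using fin by (intro card_mono) auto
  moreover have "card (branch ` ({2 * j..n} \<union> E)) = 2 * j - 1 + card E"
  proof -
    have "card (branch ` ({2 * j..n} \<union> E)) = card ({2 * j..n} \<union> E)"
      using le by (intro card_image inj_on_subset[OF branch_inj]) (auto simp: E_def)
    also have "\<dots> = card {2 * j..n} + card E"
      using j by (intro card_Un_disjoint) (auto simp: E_def p_def)
    finally show ?thesis
      using n j by simp
  qed
  moreover have "near j (branch j) \<le> 2 * j - 2 + card E"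
  proof -
    have "{w \<in> landmarks. cdist (branch j) w \<le> j} \<subseteq> branch ` ({1..2 * j - 2} \<union> E)"
    proof
      fix w assume w: "w \<in> {w \<in> landmarks. cdist (branch j) w \<le> j}"
      have "w \<noteq> spine 0"
        using w posb j pos_spine[of 0] spine_in[of 0] by (auto simp: cdist_def split: if_splits)
      then obtain k where k: "k \<le> n" "w = branch k"
        using w by (auto simp: landmarks_def)
      then have w_simps: "pos w = k" "height w = (if legs k = {} then 0 else 1)"
        by (simp_all add: pos_branch height_branch)
      have d: "k = j \<or> nat \<bar>int j - int k\<bar> + 1 + height w \<le> j"
        using w w_simps(1) posb by (auto simp: cdist_def split: if_splits)
      have "k \<noteq> 0"
        using d w_simps(2) j legs_ends[OF n_pos] by (cases "k = 0") auto
      moreover have "k \<le> p"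
        using d j unfolding p_def by linarith
      moreover have "legs p = {}" if "k = p"
        using d w_simps(2) j that by (cases "legs p = {}") (auto simp: p_def)
      ultimately show "w \<in> branch ` ({1..2 * j - 2} \<union> E)"
        using k by (cases "k = p") (auto simp: E_def p_def)
    qed
    then have "near j (branch j) \<le> card (branch ` ({1..2 * j - 2} \<union> E))"
      unfolding near_eq_card by (intro card_mono) (auto simp: E_def)
    also have "\<dots> \<le> card ({1..2 * j - 2} \<union> E)"
      by (rule card_image_le) (simp add: E_def)
    also have "\<dots> \<le> card {1..2 * j - 2} + card E"
      by (rule card_Un_le)
    finally show ?thesis
      by simp
  qed
  moreover assume "rep (spine (3 * j - 1)) landmarks = rep (branch j) landmarks"
  ultimately show False
    using j by (simp add: near_def v_def)
qed


text \<open>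
  Maximum, sum and membership of 0 suffice except in the situation of the previous lemma.
\<close>
lemma rep_landmarks_inj:
  assumes x: "x \<in> V" and y: "y \<in> V" and eq: "rep x landmarks = rep y landmarks"
  shows "x = y"
proof -
  have same_height: "u = v"
    if uv: "u \<in> V" "v \<in> V" "rep u landmarks = rep v landmarks" "height u = height v"
    for u v
  proof -
    have mem: "u \<in> landmarks \<longleftrightarrow> v \<in> landmarks"
      using that zero_in_rep_iff[OF landmarks_subset] by metis
    have "max (pos u) (n - pos u) = max (pos v) (n - pos v)"
      using uv Max_rep[of u] Max_rep[of v] by simp
    then have "pos u = pos v \<or> pos u = n - pos v"
      using pos_le[of u] pos_le[of v] uv by (auto simp: max_def split: if_splits)
    \<comment> \<open>Mirror images differ in the sum by the difference of their positions.\<close>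
    moreover have "pos u = pos v" if "pos u = n - pos v"
    proof -
      have n: "int n = int (pos u) + int (pos v)"
        using that pos_le[of v] uv by auto
      have "int (pos u) * (int (pos u) + 1) + (int n - int (pos u)) * (int n - int (pos u) + 1) + 2 * int (pos u) =
          int (pos v) * (int (pos v) + 1) + (int n - int (pos v)) * (int n - int (pos v) + 1) + 2 * int (pos v)"
        using sum_rep[OF uv(1)] sum_rep[OF uv(2)] uv(3,4) mem by (cases "u \<in> landmarks") simp_all
      then show ?thesis
        unfolding n by (simp add: algebra_simps)
    qed
    ultimately have pos: "pos u = pos v"
      by blast
    show "u = v"
    proof (cases "u \<in> S")
      case True
      then show ?thesis
        using uv(4) pos pos_inj by (auto simp: height_def split: if_splits)
    next
      case False
      then have "u \<in> legs (pos u)" "v \<in> legs (pos u)"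
        using uv pos by (auto simp: legs_def height_def split: if_splits)
      then show ?thesis
        using mem legs_in_landmarks leg_unique_off_branch by metis
    qed
  qed
  have diff_height: False
    if u: "u \<in> S" and v: "v \<in> V" "v \<notin> S" and eq: "rep u landmarks = rep v landmarks" for u v
  proof -
    let ?i = "pos u" and ?j = "pos v"
    have uV: "u \<in> V"
      using u spine_subset by blast
    have h: "height u = 0" "height v = 1"
      using u v by (auto simp: height_def)
    have le: "?i \<le> n" "?j \<le> n"
      using pos_le uV v by auto
    have mem: "u \<in> landmarks \<longleftrightarrow> v \<in> landmarks"
      using that uV zero_in_rep_iff[OF landmarks_subset] by metis
    have v_leg: "v \<in> legs ?j"
      using v by (simp add: legs_def)
    have ecc: "max ?i (n - ?i) = max ?j (n - ?j) + 1"
      using eq Max_rep[OF uV] Max_rep[OF v(1)] h by simp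
    have j_pos: "0 < ?j"
      using ecc le by (cases "?j = 0") auto
    show False
    proof (cases "u \<in> landmarks")
      case False
      \<comment> \<open>Here \<open>u\<close> is adjacent to its chosen leg, whereas the neighbour of \<open>v\<close> is not a landmark.\<close>
      then have "u \<noteq> branch ?i"
        using le(1) unfolding landmarks_def by blast
      then have "legs ?i \<noteq> {}"
        using spine_pos[OF u] branch_empty[of ?i] by metis
      then have "cdist u (branch ?i) = 1"
        using branch_legs[of ?i] u by (auto simp: cdist_def legs_def height_def)
      moreover have "branch ?i \<in> landmarks"
        using le(1) by (simp add: landmarks_def)
      ultimately have "1 \<in># rep u landmarks"
        unfolding set_mset_rep[OF landmarks_subset] by (metis imageI)
      then obtain w where w: "w \<in> landmarks" "cdist v w = 1"
        unfolding eq set_mset_rep[OF landmarks_subset] by (metis imageE)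
      have "pos w = ?j" "height w = 0"
        using w h by (auto simp: cdist_def split: if_splits)
      moreover from this have "w = branch ?j"
        using w(1) j_pos pos_branch pos_spine[of 0] by (auto simp: landmarks_def)
      ultimately show False
        using height_branch[OF le(2)] v_leg by (auto split: if_splits)
    next
      case True
      have ends: "?i \<noteq> n"
      proof
        assume "?i = n"
        then have "u = branch n"
          using True n_pos pos_branch pos_spine[of 0] unfolding landmarks_def by fastforce
        then show False
          using branch_legs[of n] legs_ends[OF n_pos] u by (auto simp: legs_def)
      qed
      have sum: "int ?i * (int ?i + 1) + (int n - int ?i) * (int n - int ?i + 1) + 2 * int ?i =
          int ?j * (int ?j + 1) + (int n - int ?j) * (int n - int ?j + 1) + 2 * int ?j + 2 * int n"
        using sum_rep[OF uV] sum_rep[OF v(1)] True mem h eq by simp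
      \<comment> \<open>The maximum puts \<open>u\<close> one step further from the middle than \<open>v\<close>, on the same or on the
        opposite side; this gives four linear relations to be tested against the sums.\<close>
      consider "?i = ?j + 1" "n - ?j \<le> ?j" | "?i + ?j = n + 1" "?j \<le> n - ?j"
        | "?i + 1 = ?j" "?j \<le> n - ?j" | "?i + ?j + 1 = n" "n - ?j \<le> ?j"
        using ecc le by (force simp: max_def split: if_splits)
      then show False
      proof cases
        case 1
        then have i: "int ?i = int ?j + 1"
          by simp
        have "int ?i = int n"
          using sum unfolding i by (simp add: algebra_simps)
        then show False
          using ends by simp
      next
        case 2
        then have i: "int ?i = int n + 1 - int ?j"
          by simp
        then have n: "int n + 2 = 4 * int ?j"
          using sum unfolding i by (simp add: algebra_simps)
        have "2 \<le> ?j"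
          using n ends 2 j_pos by (cases "?j = 1") auto
        moreover have "n = 4 * ?j - 2" "?i = 3 * ?j - 1"
          using n i by auto
        moreover have "v = branch ?j"
          using True mem legs_in_landmarks[OF v_leg] by simp
        ultimately show False
          using exceptional_pair[of ?j] v_leg spine_pos[OF u] eq by auto
      next
        case 3
        then have j: "int ?j = int ?i + 1"
          by simp
        show False
          using sum 3 unfolding j by (simp add: algebra_simps)
      next
        case 4
        then have n: "int n = int ?i + int ?j + 1"
          by simp
        show False
          using sum 4 unfolding n by (simp add: algebra_simps)
      qed
    qed
  qed
  show ?thesis
    using same_height[OF x y eq] diff_height[OF _ y _ eq] diff_height[OF _ x _ eq[symmetric]] x y
    by (cases "x \<in> S"; cases "y \<in> S") (simp_all add: height_def)
qed

end

text \<open>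
  Without an edge in the spine, all distances to a leg are determined by the height: 0 or 2 for the legs
  and 1 for the spine vertex.
\<close>
lemma ex_resolving: "\<exists>W. resolving W"
proof (cases "n = 0")
  case False
  then have "resolving landmarks"
    using rep_landmarks_inj landmarks_subset by (auto simp: resolving_def inj_on_def)
  then show ?thesis ..
next
  case True
  define c where "c = branch 0"
  have c: "c \<in> V" "pos c = 0"
    using branch_in pos_branch by (simp_all add: c_def)
  have "x = y" if x: "x \<in> V" and y: "y \<in> V" and eq: "rep x {c} = rep y {c}" for x y
  proof (cases "legs 0 = {}")
    case True
    have "pos x = 0" "pos y = 0"
      using pos_le[OF x] pos_le[OF y] \<open>n = 0\<close> by auto
    moreover have "x \<in> S" "y \<in> S"
      using True x y \<open>pos x = 0\<close> \<open>pos y = 0\<close> by (auto simp: legs_def)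
    ultimately show ?thesis
      by (simp add: pos_inj)
  next
    case False
    then have "c \<in> legs 0"
      using branch_legs by (simp add: c_def)
    then have hc: "height c = 1"
      by (simp add: legs_height)
    have pos: "pos x = 0" "pos y = 0"
      using pos_le[OF x] pos_le[OF y] \<open>n = 0\<close> by auto
    have "cdist x c = cdist y c"
      using eq by (simp add: rep_def)
    then consider "x = c" "y = c" | "x \<noteq> c" "y \<noteq> c" "height x = height y"
      using pos c hc by (auto simp: cdist_def split: if_splits)
    then show ?thesis
    proof cases
      case 2
      then show ?thesis
        using pos x y pos_inj[of x y] leg_unique_off_branch[of x 0 y]
        by (auto simp: legs_def c_def height_def split: if_splits)
    qed simp
  qed
  then have "resolving {c}"
    using c by (auto simp: resolving_def inj_on_def)
  then show ?thesis ..
qed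

end

theorem (in caterpillar_metric) ex_resolving_iff:
  assumes "0 < n \<Longrightarrow> legs 0 \<noteq> {} \<and> legs n \<noteq> {}"
  shows "(\<exists>W. resolving W) \<longleftrightarrow> (\<forall>k. card (legs k) \<le> 2)"
proof
  assume "\<forall>k. card (legs k) \<le> 2"
  then interpret short_legged_caterpillar n V S pos
    using assms by unfold_locales auto
  show "\<exists>W. resolving W"
    by (rule ex_resolving)
qed (use resolving_card_legs_le in blast)

section \<open>Walks given by vertex lists\<close>

lemma set_vwalk_arcs_conv_nth:
  "set (vwalk_arcs p) = {(p ! i, p ! Suc i) | i. Suc i < length p}"
proof (induction p rule: vwalk_arcs.induct)
  case (3 x y xs)
  have "{f i | i. i < Suc m} = insert (f 0) {f (Suc i) | i. i < m}"
    for f :: "nat \<Rightarrow> 'a \<times> 'a" and m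
    by (auto simp: less_Suc_eq_0_disj)
  from this[of "\<lambda>i. ((x # y # xs) ! i, (x # y # xs) ! Suc i)" "length xs"]
  show ?case
    using 3 by simp
qed auto

context wf_digraph
begin

lemma vwalk_imp_awalk:
  assumes "vwalk p G"
  shows "\<exists>es. awalk (hd p) es (last p) \<and> awalk_verts (hd p) es = p"
  using assms
proof (induction rule: vwalk_induct)
  case (Base u)
  then show ?case
    by (intro exI[of _ "[]"]) (simp add: awalk_Nil_iff)
next
  case (Cons u v vs)
  then obtain es where es: "awalk v es (last (v # vs))" "awalk_verts v es = v # vs"
    by auto
  obtain e where "e \<in> arcs G" "tail G e = u" "head G e = v"
    using Cons(1) by auto
  then show ?case
    using es by (intro exI[of _ "e # es"]) (auto simp: awalk_Cons_iff)
qed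

lemma vpath_imp_apath:
  assumes "vpath p G"
  obtains es where "apath (hd p) es (last p)" "awalk_verts (hd p) es = p" "length p = Suc (length es)"
proof -
  obtain es where "awalk (hd p) es (last p)" "awalk_verts (hd p) es = p"
    using assms vwalk_imp_awalk by blast
  then show ?thesis
    using assms that[of es] length_awalk_verts[of "hd p" es] by (auto simp: apath_def)
qed

lemma set_vwalk_arcs_awalk_verts:
  "awalk u p v \<Longrightarrow> set (vwalk_arcs (awalk_verts u p)) = arc_to_ends G ` set p"
proof (induction p arbitrary: u)
  case (Cons e es)
  then have "awalk (head G e) es v"
    by (simp add: awalk_Cons_iff)
  then show ?case
    using Cons.IH by (auto simp: arc_to_ends_def)
qed simp

text \<open>
  In an acyclic graph a path whose ends are adjacent is a single edge.
\<close>
lemma vpath_closing_arc_short: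
  assumes acyclic: "\<not> (\<exists>c. cycle c \<and> 3 \<le> length c)"
    and p: "vpath p G" and arc: "last p \<rightarrow> hd p"
  shows "length p \<le> 2"
proof (rule ccontr)
  assume long: "\<not> length p \<le> 2"
  obtain es where es: "apath (hd p) es (last p)" "awalk_verts (hd p) es = p"
    "length p = Suc (length es)"
    using p by (rule vpath_imp_apath)
  obtain e where e: "e \<in> arcs G" "tail G e = last p" "head G e = hd p"
    using arc by auto
  have "cycle (e # es)"
    unfolding cycle_def using es e p
    by (intro exI[of _ "last p"]) (auto simp: apath_def awalk_Cons_iff)
  moreover have "3 \<le> length (e # es)"
    using long es(3) by simp
  ultimately show False
    using acyclic by blast
qed

end

section \<open>Distances in a caterpillar graph\<close>

text \<open>
  The last assumption is what being a 1-center-path means in terms of adjacency. The path is kept as a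
  vertex list because positions, prefixes and reversals are taken of it.
\<close>
locale caterpillar_graph = graph G for G :: "('a, 'b) pre_digraph" (structure) +
  fixes vs :: "'a list"
  assumes acyclic: "\<not> (\<exists>c. cycle c \<and> 3 \<le> length c)"
    and vpath_spine: "vpath vs G"
    and dominating: "x \<in> verts G \<Longrightarrow> x \<notin> set vs \<Longrightarrow> \<exists>w\<in>set vs. x \<rightarrow> w"
begin

text \<open>
  Choosing some adjacent spine vertex for a vertex off the spine is harmless: it turns out to be the only
  one (\<open>legs_eq_neighbors\<close>).
\<close>
definition position :: "'a \<Rightarrow> nat" where
  "position x = (SOME i. i < length vs \<and> (x = vs ! i \<or> x \<notin> set vs \<and> x \<rightarrow> vs ! i))"

lemma spine_verts: "set vs \<subseteq> verts G" and spine_distinct: "distinct vs" and spine_nonempty: "vs \<noteq> []"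
  using vpath_spine by (auto simp: vpath_def vwalk_def)

lemma position_props:
  assumes "x \<in> verts G"
  shows "position x < length vs"
    and "x \<in> set vs \<Longrightarrow> vs ! position x = x"
    and "x \<notin> set vs \<Longrightarrow> x \<rightarrow> vs ! position x"
proof -
  have "\<exists>i. i < length vs \<and> (x = vs ! i \<or> x \<notin> set vs \<and> x \<rightarrow> vs ! i)"
    using dominating[OF assms] by (metis in_set_conv_nth)
  then have *: "position x < length vs \<and> (x = vs ! position x \<or> x \<notin> set vs \<and> x \<rightarrow> vs ! position x)"
    unfolding position_def by (rule someI_ex)
  then show "position x < length vs"
    by blast
  show "vs ! position x = x" if "x \<in> set vs"
    using * that by metis
  show "x \<rightarrow> vs ! position x" if "x \<notin> set vs"
    using * that by (metis nth_mem)
qed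

lemma position_nth:
  assumes "i < length vs"
  shows "position (vs ! i) = i"
proof -
  have "vs ! i \<in> set vs" "vs ! i \<in> verts G"
    using assms spine_verts by auto
  then have "position (vs ! i) < length vs" "vs ! position (vs ! i) = vs ! i"
    using position_props(1,2) by blast+
  then show ?thesis
    using assms spine_distinct by (simp add: nth_eq_iff_index_eq)
qed

sublocale caterpillar_metric "length vs - 1" "verts G" "set vs" position
proof
  have idx: "{..length vs - 1} = {..<length vs}"
    using spine_nonempty by (cases vs) auto
  show "bij_betw position (set vs) {..length vs - 1}"
    unfolding idx
  proof (rule bij_betwI[where g = "(!) vs"])
    show "position \<in> set vs \<rightarrow> {..<length vs}"
      using position_props(1) spine_verts by blast
    show "(!) vs \<in> {..<length vs} \<rightarrow> set vs"
      by simp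
    show "vs ! position x = x" if "x \<in> set vs" for x
      using that position_props(2) spine_verts by blast
    show "position (vs ! i) = i" if "i \<in> {..<length vs}" for i
      using that position_nth by simp
  qed
  show "position x \<le> length vs - 1" if "x \<in> verts G" for x
    using position_props(1)[OF that] by simp
qed (use spine_verts in auto)

text \<open>
  The path climbs from \<open>x\<close> to the spine if \<open>x\<close> is a leg, follows the spine, and descends to \<open>y\<close>. It has
  the length that the metric predicts.
\<close>
lemma vpath_between_ordered:
  assumes x: "x \<in> verts G" and y: "y \<in> verts G" and "x \<noteq> y" and le: "position x \<le> position y"
  shows "\<exists>p. vpath p G \<and> hd p = x \<and> last p = y \<and> length p = Suc (cdist x y)"
proof -
  define s where "s = take (Suc (position y - position x)) (drop (position x) vs)"
  have len: "length s = Suc (position y - position x)"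
    using position_props(1)[OF y] le by (simp add: s_def)
  then have ne: "s \<noteq> []"
    by auto
  have "vwalk (take (position x) vs @ drop (position x) vs) G"
    using vpath_spine by (simp add: vpath_def)
  then have "vwalk (drop (position x) vs) G"
    by (rule vwalkI_append_r[rotated]) (simp add: position_props(1)[OF x] not_le)
  then have "vwalk (s @ drop (Suc (position y - position x)) (drop (position x) vs)) G"
    unfolding s_def append_take_drop_id .
  then have walk: "vwalk s G"
    by (rule vwalkI_append_l[OF ne])
  have dist: "distinct s" and sub: "set s \<subseteq> set vs"
    using spine_distinct set_take_subset set_drop_subset unfolding s_def
    by (auto dest: in_set_takeD in_set_dropD)
  have hd: "hd s = vs ! position x"
    using position_props(1)[OF x] ne by (simp add: s_def hd_drop_conv_nth)
  have last: "last s = vs ! position y"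
    using position_props(1)[OF y] ne le len by (simp add: last_conv_nth) (simp add: s_def)
  define t where "t = (if x \<in> set vs then s else x # s)"
  have t: "vwalk t G" "t \<noteq> []" "distinct t" "hd t = x" "last t = vs ! position y"
      "length t = Suc (position y - position x + height x)" "set t \<subseteq> insert x (set vs)"
    using walk ne dist sub hd last len position_props[OF x] x
    by (auto simp: t_def height_def intro!: vwalk_consI)
  define q where "q = (if y \<in> set vs then t else t @ [y])"
  have "vwalk q G"
  proof (cases "y \<in> set vs")
    case False
    then have "y \<rightarrow> last t"
      using t(5) position_props(3)[OF y] by simp
    then have "last t \<rightarrow> y"
      by (rule graph_symmetric)
    then show ?thesis
      using t(1,2) False y by (auto simp: q_def vwalk_def set_vwalk_arcs_snoc)
  qed (simp add: q_def t)
  moreover have "distinct q"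
    using t(3,7) \<open>x \<noteq> y\<close> by (auto simp: q_def)
  moreover have "hd q = x" "last q = y"
    using t(2,4,5) position_props(2)[OF y] by (auto simp: q_def)
  moreover have "length q = Suc (cdist x y)"
    using t(6) \<open>x \<noteq> y\<close> le by (auto simp: q_def cdist_def height_def)
  ultimately show ?thesis
    by (auto simp: vpath_def)
qed

lemma vpath_between:
  assumes x: "x \<in> verts G" and y: "y \<in> verts G"
  shows "\<exists>p. vpath p G \<and> hd p = x \<and> last p = y \<and> length p = Suc (cdist x y)"
proof -
  consider "x = y" | "x \<noteq> y" "position x \<le> position y" | "x \<noteq> y" "position y \<le> position x"
    by linarith
  then show ?thesis
  proof cases
    case 1
    then show ?thesis
      using x by (intro exI[of _ "[x]"]) (simp add: vpath_self cdist_def)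
  next
    case 2
    then show ?thesis
      using vpath_between_ordered x y by blast
  next
    case 3
    then obtain p where p: "vpath p G" "hd p = y" "last p = x" "length p = Suc (cdist y x)"
      using vpath_between_ordered[OF y x] by blast
    then have "vpath (rev p) G"
      using vwalk_rev_ex[OF sym_arcs] by (simp add: vpath_def)
    then show ?thesis
      using p by (intro exI[of _ "rev p"]) (auto simp: hd_rev last_rev cdist_sym)
  qed
qed

text \<open>
  An edge closes the canonical path between its ends to a cycle unless that path is the edge itself. Hence
  the graph has no edges but those of the spine and those between a leg and its spine vertex.
\<close>
lemma adjacent_iff_cdist:
  assumes "x \<in> verts G" "y \<in> verts G"
  shows "x \<rightarrow> y \<longleftrightarrow> cdist x y = 1"
proof
  assume adj: "x \<rightarrow> y"
  obtain p where p: "vpath p G" "hd p = y" "last p = x" "length p = Suc (cdist y x)"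
    using vpath_between assms by blast
  then have "length p \<le> 2"
    using vpath_closing_arc_short[OF acyclic] adj by blast
  moreover have "x \<noteq> y"
    using adj adj_not_same by blast
  ultimately show "cdist x y = 1"
    using p(4) cdist_eq_0_iff[OF assms] by (simp add: cdist_sym)
next
  assume "cdist x y = 1"
  then obtain p where p: "vpath p G" "hd p = x" "last p = y" "length p = 2"
    using vpath_between[OF assms] by auto
  then have "p = [x, y]"
    by (auto simp: length_Suc_conv numeral_2_eq_2)
  then show "x \<rightarrow> y"
    using p(1) by (simp add: vpath_def vwalk_def)
qed

text \<open>
  By the triangle inequality, the metric grows by at most one along each edge.
\<close>
lemma cdist_le_length_awalk:
  "awalk x p y \<Longrightarrow> cdist x y \<le> length p"
proof (induction p arbitrary: x)
  case Nil
  then show ?case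
    by (simp add: awalk_Nil_iff cdist_def)
next
  case (Cons e es)
  then have e: "x \<rightarrow> head G e" and es: "awalk (head G e) es y"
    by (auto simp: awalk_Cons_iff intro: in_arcs_imp_in_arcs_ends)
  then have "cdist x (head G e) = 1"
    using adjacent_iff_cdist adj_in_verts[OF e] by blast
  then show ?case
    using Cons.IH[OF es] cdist_triangle[of x y "head G e"] by simp
qed

lemma graph_dist_eq_cdist:
  assumes "x \<in> verts G" "y \<in> verts G"
  shows "graph_dist G x y = cdist x y"
  unfolding graph_dist_def
proof (rule Least_equality)
  obtain p where "vpath p G" "hd p = x" "last p = y" "length p = Suc (cdist x y)"
    using vpath_between[OF assms] by blast
  then show "\<exists>p. apath x p y \<and> length p = cdist x y"
    by (metis nat.inject vpath_imp_apath)
  show "cdist x y \<le> d" if "\<exists>p. apath x p y \<and> length p = d" for d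
    using that cdist_le_length_awalk awalkI_apath by blast
qed

lemma m_resolving_iff: "m_resolving G W \<longleftrightarrow> resolving W"
proof -
  have "rep_mset G x W = rep x W" if "x \<in> verts G" "W \<subseteq> verts G" for x
  proof -
    have "finite W"
      using that(2) finite_verts finite_subset by blast
    then show ?thesis
      unfolding rep_mset_def rep_def
      using that by (intro image_mset_cong) (auto intro: graph_dist_eq_cdist)
  qed
  then show ?thesis
    unfolding m_resolving_def resolving_def inj_on_def by metis
qed

lemma legs_eq_neighbors:
  assumes "i < length vs"
  shows "legs i = {w \<in> verts G - set vs. vs ! i \<rightarrow> w}"
proof -
  have "vs ! i \<in> verts G" "vs ! i \<in> set vs" "position (vs ! i) = i"
    using assms spine_verts position_nth by auto
  then have "vs ! i \<rightarrow> w \<longleftrightarrow> position w = i" if "w \<in> verts G - set vs" for w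
    using that adjacent_iff_cdist[of "vs ! i" w] by (auto simp: cdist_def height_def)
  then show ?thesis
    by (auto simp: legs_def)
qed

section \<open>Center paths and the spine\<close>

text \<open>
  The subgraph induced on the spine has no arcs besides those of the path, because adjacent spine
  vertices have consecutive positions. So a shorter dominating path is a shorter 1-center-path, which
  is how minimality is exploited.
\<close>
lemma center_path_spine: "center_path G 1 (G \<restriction> set vs)"
  and path_graph_spine: "path_graph (G \<restriction> set vs) (length vs - 1)"
proof -
  let ?H = "G \<restriction> set vs"
  have ind: "induced_subgraph ?H G"
    using spine_verts by blast
  interpret H: digraph ?H
    using ind by (rule digraphI_induced)
  interpret H: sym_digraph ?H
    using ind by (rule induced_graph_imp_graph)
  have graph: "graph ?H"
    by (rule H.graphI) (rule H.sym_arcs)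
  obtain es where es: "apath (hd vs) es (last vs)" "awalk_verts (hd vs) es = vs"
    "length vs = Suc (length es)"
    using vpath_spine by (rule vpath_imp_apath)
  have walk: "H.awalk (hd vs) es (last vs)"
    using es by (intro awalk_induce) (auto simp: apath_def)
  have verts: "H.awalk_verts (hd vs) es = vs"
    using es(2) by (simp add: awalk_verts_induce)
  have path: "H.apath (hd vs) es (last vs)"
    using walk verts spine_distinct by (simp add: H.apath_def)
  have arcs: "arc_to_ends ?H ` set es = set (vwalk_arcs vs)"
    using H.set_vwalk_arcs_awalk_verts[OF walk] verts by simp
  have "arcs_ends ?H = set (vwalk_arcs vs) \<union> (set (vwalk_arcs vs))\<inverse>"
  proof
    have "set es \<subseteq> arcs ?H"
      using walk by (auto simp: H.awalk_def)
    then have "set (vwalk_arcs vs) \<subseteq> arcs_ends ?H"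
      unfolding arcs[symmetric] arcs_ends_def by blast
    then show "set (vwalk_arcs vs) \<union> (set (vwalk_arcs vs))\<inverse> \<subseteq> arcs_ends ?H"
      using H.graph_symmetric by auto
    show "arcs_ends ?H \<subseteq> set (vwalk_arcs vs) \<union> (set (vwalk_arcs vs))\<inverse>"
    proof (rule subrelI)
      fix x y assume xy: "(x, y) \<in> arcs_ends ?H"
      then have S: "x \<in> set vs" "y \<in> set vs"
        using H.adj_in_verts by auto
      then obtain i j where ij: "x = vs ! i" "y = vs ! j" "i < length vs" "j < length vs"
        by (metis in_set_conv_nth)
      have "x \<rightarrow> y"
        using xy by (rule dominates_induce_subgraphD)
      then have "cdist x y = 1"
        using S spine_verts adjacent_iff_cdist by blast
      then have "j = Suc i \<or> i = Suc j"
        using S ij position_nth by (auto simp: cdist_def height_def split: if_splits)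
      then show "(x, y) \<in> set (vwalk_arcs vs) \<union> (set (vwalk_arcs vs))\<inverse>"
        using ij by (auto simp: set_vwalk_arcs_conv_nth)
    qed
  qed
  then have "arcs_ends ?H = arc_to_ends ?H ` set es \<union> (arc_to_ends ?H ` set es)\<inverse>"
    by (simp only: arcs)
  then show path_graph: "path_graph ?H (length vs - 1)"
    unfolding path_graph_def using graph path verts es(3)
    by (intro conjI exI[of _ "hd vs"] exI[of _ es] exI[of _ "last vs"]) auto
  have "Min (graph_dist G x ` verts ?H) \<le> 1" if x: "x \<in> verts G" for x
  proof -
    have "\<exists>w\<in>set vs. graph_dist G x w \<le> 1"
    proof (cases "x \<in> set vs")
      case True
      then show ?thesis
        using x by (intro bexI[of _ x]) (auto simp: graph_dist_eq_cdist cdist_def)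
    next
      case False
      then obtain w where "w \<in> set vs" "x \<rightarrow> w"
        using dominating x by blast
      then show ?thesis
        using x spine_verts adjacent_iff_cdist[of x w] graph_dist_eq_cdist[of x w]
        by (intro bexI[of _ w]) auto
    qed
    then show ?thesis
      using spine_nonempty by (simp add: Min_le_iff)
  qed
  then show "center_path G 1 ?H"
    using path_graph induced_imp_subgraph[OF ind] by (auto simp: center_path_def)
qed

text \<open>
  An end of the spine without legs can be cut off, as it is dominated by the next vertex.
\<close>
lemma caterpillar_graph_tl:
  assumes "1 < length vs" and no_legs: "\<And>w. w \<in> verts G - set vs \<Longrightarrow> \<not> hd vs \<rightarrow> w"
  shows "caterpillar_graph G (tl vs)"
proof
  obtain a b r where vs: "vs = a # b # r"
    using assms(1) by (cases vs; cases "tl vs") auto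
  show "vpath (tl vs) G"
    using vpath_spine vs by (auto simp: vpath_def)
  show "\<exists>w\<in>set (tl vs). x \<rightarrow> w" if x: "x \<in> verts G" "x \<notin> set (tl vs)" for x
  proof (cases "x = a")
    case True
    then show ?thesis
      using vpath_spine vs by (auto simp: vpath_def)
  next
    case False
    then have x': "x \<in> verts G - set vs"
      using x vs by simp
    then obtain w where w: "w \<in> set vs" "x \<rightarrow> w"
      using dominating by blast
    then have "w \<noteq> a"
      using no_legs[OF x'] graph_symmetric vs by auto
    then show ?thesis
      using w vs by auto
  qed
qed (rule acyclic)

lemma caterpillar_graph_rev: "caterpillar_graph G (rev vs)"
  using acyclic vpath_spine vwalk_rev_ex[OF sym_arcs] dominating
  by unfold_locales (auto simp: vpath_def)

text \<open>
  The two ends are exchanged by reversing the path, so it suffices to consider the first vertex.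
\<close>
lemma ends_have_legs:
  assumes minimal: "\<And>ws. caterpillar_graph G ws \<Longrightarrow> length vs \<le> length ws"
    and long: "0 < length vs - 1"
  shows "legs 0 \<noteq> {} \<and> legs (length vs - 1) \<noteq> {}"
proof -
  have "\<exists>w\<in>verts G - set us. hd us \<rightarrow> w"
    if us: "caterpillar_graph G us" "length us = length vs" for us
  proof (rule ccontr)
    assume "\<not> ?thesis"
    then have "caterpillar_graph G (tl us)"
      using caterpillar_graph.caterpillar_graph_tl[OF us(1)] us(2) long by force
    then show False
      using minimal[of "tl us"] us(2) long by simp
  qed
  from this[OF caterpillar_graph_axioms refl] this[OF caterpillar_graph_rev]
  have "\<exists>w\<in>verts G - set vs. hd vs \<rightarrow> w" "\<exists>w\<in>verts G - set vs. last vs \<rightarrow> w"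
    by (simp_all add: hd_rev)
  then show ?thesis
    using spine_nonempty by (auto simp: legs_eq_neighbors hd_conv_nth last_conv_nth)
qed

end

text \<open>
  A minimum over distances that is at most 1 yields an adjacent vertex of the path, because connectedness
  guarantees that the distances are attained.
\<close>
lemma center_path_imp_caterpillar_graph:
  assumes tree: "undirected_tree G" and center: "center_path G 1 P" and path: "path_graph P n"
  obtains vs where "caterpillar_graph G vs" "set vs = verts P" "length vs = Suc n"
proof -
  interpret G: graph G
    using tree by (simp add: undirected_tree_def)
  have conn: "x \<rightarrow>\<^sup>*\<^bsub>G\<^esub> y" if "x \<in> verts G" "y \<in> verts G" for x y
  proof -
    have "x \<rightarrow>\<^sup>*\<^bsub>mk_symmetric G\<^esub> y"
      using tree that by (simp add: undirected_tree_def connected_def strongly_connected_def)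
    then show ?thesis
      by (simp only: G.reachable_mk_symmetric_eq[OF G.sym_arcs])
  qed
  have sub: "subgraph P G"
    using center by (simp add: center_path_def)
  interpret P: graph P
    using path by (simp add: path_graph_def)
  obtain u p v where p: "P.apath u p v" "length p = n" "verts P = set (P.awalk_verts u p)"
    using path by (auto simp: path_graph_def)
  define vs where "vs = P.awalk_verts u p"
  have "vwalk vs P"
    using P.awalk_imp_vwalk[OF P.awalkI_apath[OF p(1)]] by (simp add: vs_def)
  then have "vpath vs G"
    using arcs_ends_mono[OF sub] subgraph_imp_subverts[OF sub] p(1)
    by (auto simp: vpath_def vwalk_def vs_def P.apath_def)
  moreover have "\<exists>w\<in>set vs. x \<rightarrow>\<^bsub>G\<^esub> w" if x: "x \<in> verts G" "x \<notin> set vs" for x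
  proof -
    have "Min (graph_dist G x ` verts P) \<le> 1"
      using center x(1) by (simp add: center_path_def)
    moreover have "finite (verts P)" "verts P \<noteq> {}"
      by (simp_all add: p(3))
    ultimately obtain w where w: "w \<in> verts P" "graph_dist G x w \<le> 1"
      by (auto simp: Min_le_iff)
    have "x \<rightarrow>\<^sup>*\<^bsub>G\<^esub> w"
      using conn x(1) w(1) subgraph_imp_subverts[OF sub] by blast
    then have "\<exists>d q. G.apath x q w \<and> length q = d"
      by (auto simp: G.reachable_apath)
    then obtain q where q: "G.apath x q w" "length q \<le> 1"
      using w(2) LeastI_ex[of "\<lambda>d. \<exists>q. G.apath x q w \<and> length q = d"]
      unfolding graph_dist_def by auto
    have "x \<noteq> w"
      using w(1) x(2) p(3) vs_def by auto
    then obtain e where "q = [e]"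
      using q by (cases q) (auto simp: G.apath_def G.awalk_def)
    then have "x \<rightarrow>\<^bsub>G\<^esub> w"
      using q(1) by (auto simp: G.apath_simps intro: G.in_arcs_imp_in_arcs_ends)
    then show ?thesis
      using w(1) p(3) vs_def by auto
  qed
  ultimately have "caterpillar_graph G vs"
    using tree by unfold_locales (auto simp: undirected_tree_def)
  then show thesis
    using that p(2,3) P.length_awalk_verts by (simp add: vs_def)
qed

theorem theorem3:
  fixes G P :: "('a, 'b) pre_digraph"
  assumes "caterpillar G"
    and "minimum_center_path G 1 P"
  shows "multiset_dim G < \<infinity> \<longleftrightarrow>
    (\<forall>v\<in>verts P. card (neighbors_in G v (delete_verts_of G P)) \<le> 2)"
proof -
  obtain n where center: "center_path G 1 P" and n: "path_graph P n"
    and minimal: "\<And>Q m. center_path G 1 Q \<Longrightarrow> path_graph Q m \<Longrightarrow> n \<le> m"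
    using assms(2) by (auto simp: minimum_center_path_def)
  have "undirected_tree G"
    using assms(1) by (simp add: caterpillar_def)
  then obtain vs where "caterpillar_graph G vs" and vs: "set vs = verts P" "length vs = Suc n"
    using center n by (rule center_path_imp_caterpillar_graph)
  then interpret caterpillar_graph G vs
    by simp
  have shortest: "length vs \<le> length ws" if ws: "caterpillar_graph G ws" for ws
    using minimal[OF caterpillar_graph.center_path_spine[OF ws] caterpillar_graph.path_graph_spine[OF ws]]
      caterpillar_graph.spine_nonempty[OF ws] vs(2) by (cases ws) auto
  have "multiset_dim G < \<infinity> \<longleftrightarrow> (\<exists>W. m_resolving G W)"
    by (simp add: multiset_dim_def)
  also have "\<dots> \<longleftrightarrow> (\<forall>k. card (legs k) \<le> 2)"
    using ex_resolving_iff[OF ends_have_legs[OF shortest]] by (simp add: m_resolving_iff)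
  also have "\<dots> \<longleftrightarrow> (\<forall>k<length vs. card (legs k) \<le> 2)"
  proof -
    have "legs k = {}" if "\<not> k < length vs" for k
      using that position_props(1) by (auto simp: legs_def)
    then show ?thesis
      by (metis card.empty zero_le)
  qed
  also have "\<dots> \<longleftrightarrow> (\<forall>v\<in>set vs. card {w \<in> verts G - set vs. v \<rightarrow>\<^bsub>G\<^esub> w} \<le> 2)"
    by (simp add: all_set_conv_all_nth legs_eq_neighbors)
  also have "\<dots> \<longleftrightarrow> (\<forall>v\<in>verts P. card (neighbors_in G v (delete_verts_of G P)) \<le> 2)"
    by (simp add: vs(1) neighbors_in_def delete_verts_of_def)
  finally show ?thesis .
qed

end
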